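(* Let $K$ be a field and let $\mathbf{Vec}$ be the category of vector spaces over $K$ and linear maps. All vector spaces of countable dimension form a colimit-dense subcategory of $\mathbf{Vec}^{\mathrm{op}}$.
   Context: A small, full subcategory $\mathcal{G}$ of a category $\mathcal{K}$ is called colimit-dense if every object of $\mathcal{K}$ is a colimit (in $\mathcal{K}$) of some small diagram in $\mathcal{G}$. (Colimits in $\mathbf{Vec}^{\mathrm{op}}$ are limits in $\mathbf{Vec}$.) The full subcategory of spaces of countable dimension (i.e. of dimension at most $\aleph_0$) is regarded as small by choosing a representative set of its objects up to isomorphism. *)

theory Defs
  imports "HOL-Library.FuncSet" "HOL-Library.Equipollence" "HOL-Library.Countable_Set"
    "Jordan_Normal_Form.Missing_VectorSpace"
begin

section \<open>Smallness\<close>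

text \<open>
  Smallness is relative to a universe of small sets. \<open>S A\<close> says that the set \<open>A\<close> of elements of
  the type \<open>'u\<close> is small; \<open>small S\<close> extends this to sets of elements of other types.
  \<open>'u\<close> itself plays the role of the class of all elements of small sets. The only closure property
  demanded is that whatever is at most as large as the power set of a small set is small again
  (as far as it fits into \<open>'u\<close>), and there is to be an infinite small set. This covers both usual
  readings of ``small'' in HOL: Grothendieck universes (\<open>universe_lesspoll\<close> below, to be used with
  \<open>'u\<close> of inaccessible cardinality), and the reading of ``small'' as ``being a set of
  elements of some type'' (\<open>universe_True\<close>).
\<close>

definition small :: "('u set \<Rightarrow> bool) \<Rightarrow> 'a set \<Rightarrow> bool" where
  "small S X \<longleftrightarrow> (\<exists>A. S A \<and> X \<lesssim> Pow A)"

definition universe :: "('u set \<Rightarrow> bool) \<Rightarrow> bool" where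
  "universe S \<longleftrightarrow> (\<forall>A. small S A \<longrightarrow> S A) \<and> (\<exists>A. infinite A \<and> S A)"

lemma universe_True:
  assumes "infinite (UNIV :: 'u set)"
  shows "universe (\<lambda>_ :: 'u set. True)"
  using assms by (auto simp: universe_def)

lemma universe_lesspoll:
  assumes unc: "\<not> countable (UNIV :: 'u set)"
    and limit: "\<And>A :: 'u set. A \<prec> (UNIV :: 'u set) \<Longrightarrow> Pow A \<prec> (UNIV :: 'u set)"
  shows "universe (\<lambda>A :: 'u set. A \<prec> (UNIV :: 'u set))"
proof -
  have "infinite (UNIV :: 'u set)"
    using unc countable_finite by blast
  then obtain A :: "'u set" where A: "countable A" "infinite A"
    by (meson infinite_countable_subset')
  have "A \<prec> (UNIV :: 'u set)"
    using A unc by (meson countable_eqpoll lesspoll_def subset_UNIV subset_imp_lepoll eqpoll_sym)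
  with A limit show ?thesis
    unfolding universe_def small_def by (meson lesspoll_trans1)
qed


section \<open>Categories\<close>

record ('o, 'm) category =
  Obj :: "'o set"
  Arr :: "'m set"
  Dom :: "'m \<Rightarrow> 'o"
  Cod :: "'m \<Rightarrow> 'o"
  Ident :: "'o \<Rightarrow> 'm"
  Comp :: "'m \<Rightarrow> 'm \<Rightarrow> 'm"

text \<open>\<open>Comp C g f\<close> is the composite ``\<open>g\<close> after \<open>f\<close>''; it is meaningful only if
  \<open>Dom C g = Cod C f\<close>.\<close>

definition homset :: "('o, 'm) category \<Rightarrow> 'o \<Rightarrow> 'o \<Rightarrow> 'm set" where
  "homset C X Y = {f \<in> Arr C. Dom C f = X \<and> Cod C f = Y}"

definition is_category :: "('o, 'm) category \<Rightarrow> bool" where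
  "is_category C \<longleftrightarrow>
     (\<forall>f\<in>Arr C. Dom C f \<in> Obj C \<and> Cod C f \<in> Obj C) \<and>
     (\<forall>X\<in>Obj C. Ident C X \<in> homset C X X) \<and>
     (\<forall>f\<in>Arr C. \<forall>g\<in>Arr C. Cod C f = Dom C g \<longrightarrow> Comp C g f \<in> homset C (Dom C f) (Cod C g)) \<and>
     (\<forall>f\<in>Arr C. Comp C f (Ident C (Dom C f)) = f \<and> Comp C (Ident C (Cod C f)) f = f) \<and>
     (\<forall>f\<in>Arr C. \<forall>g\<in>Arr C. \<forall>h\<in>Arr C. Cod C f = Dom C g \<longrightarrow> Cod C g = Dom C h \<longrightarrow>
        Comp C h (Comp C g f) = Comp C (Comp C h g) f)"

definition op_cat :: "('o, 'm) category \<Rightarrow> ('o, 'm) category" where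
  "op_cat C = \<lparr>Obj = Obj C, Arr = Arr C, Dom = Cod C, Cod = Dom C, Ident = Ident C,
               Comp = (\<lambda>g f. Comp C f g)\<rparr>"

definition full_subcat :: "('o, 'm) category \<Rightarrow> 'o set \<Rightarrow> ('o, 'm) category" where
  "full_subcat C G = C\<lparr>Obj := G, Arr := {f \<in> Arr C. Dom C f \<in> G \<and> Cod C f \<in> G}\<rparr>"

definition small_cat :: "('u set \<Rightarrow> bool) \<Rightarrow> ('o, 'm) category \<Rightarrow> bool" where
  "small_cat S C \<longleftrightarrow> small S (Obj C) \<and> small S (Arr C)"

definition isomorphic :: "('o, 'm) category \<Rightarrow> 'o \<Rightarrow> 'o \<Rightarrow> bool" where
  "isomorphic C X Y \<longleftrightarrow>
     (\<exists>f \<in> homset C X Y. \<exists>g \<in> homset C Y X. Comp C g f = Ident C X \<and> Comp C f g = Ident C Y)"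

text \<open>\<open>R\<close> contains exactly one object from each isomorphism class of objects of \<open>P\<close>.\<close>

definition representative_set :: "('o, 'm) category \<Rightarrow> 'o set \<Rightarrow> 'o set \<Rightarrow> bool" where
  "representative_set C P R \<longleftrightarrow> R \<subseteq> P \<and> (\<forall>X\<in>P. \<exists>!Y. Y \<in> R \<and> isomorphic C X Y)"

lemma is_category_op: "is_category C \<Longrightarrow> is_category (op_cat C)"
  by (auto simp: is_category_def op_cat_def homset_def)

lemma is_category_full_subcat: "is_category C \<Longrightarrow> G \<subseteq> Obj C \<Longrightarrow> is_category (full_subcat C G)"
  by (auto simp: is_category_def full_subcat_def homset_def subset_iff)


section \<open>Colimits\<close>

text \<open>A diagram of shape \<open>J\<close> in \<open>C\<close> is a functor from \<open>J\<close> to \<open>C\<close>, given by its object part \<open>Fo\<close>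
  and its arrow part \<open>Fa\<close>.\<close>

definition diagram ::
  "('i, 'j) category \<Rightarrow> ('o, 'm) category \<Rightarrow> ('i \<Rightarrow> 'o) \<Rightarrow> ('j \<Rightarrow> 'm) \<Rightarrow> bool" where
  "diagram J C Fo Fa \<longleftrightarrow>
     (\<forall>i\<in>Obj J. Fo i \<in> Obj C) \<and>
     (\<forall>a\<in>Arr J. Fa a \<in> homset C (Fo (Dom J a)) (Fo (Cod J a))) \<and>
     (\<forall>i\<in>Obj J. Fa (Ident J i) = Ident C (Fo i)) \<and>
     (\<forall>a\<in>Arr J. \<forall>b\<in>Arr J. Cod J a = Dom J b \<longrightarrow> Fa (Comp J b a) = Comp C (Fa b) (Fa a))"

definition cocone ::
  "('i, 'j) category \<Rightarrow> ('o, 'm) category \<Rightarrow> ('i \<Rightarrow> 'o) \<Rightarrow> ('j \<Rightarrow> 'm) \<Rightarrow> 'o \<Rightarrow> ('i \<Rightarrow> 'm) \<Rightarrow> bool" where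
  "cocone J C Fo Fa X \<iota> \<longleftrightarrow>
     X \<in> Obj C \<and>
     (\<forall>i\<in>Obj J. \<iota> i \<in> homset C (Fo i) X) \<and>
     (\<forall>a\<in>Arr J. Comp C (\<iota> (Cod J a)) (Fa a) = \<iota> (Dom J a))"

definition is_colimit ::
  "('i, 'j) category \<Rightarrow> ('o, 'm) category \<Rightarrow> ('i \<Rightarrow> 'o) \<Rightarrow> ('j \<Rightarrow> 'm) \<Rightarrow> 'o \<Rightarrow> ('i \<Rightarrow> 'm) \<Rightarrow> bool" where
  "is_colimit J C Fo Fa X \<iota> \<longleftrightarrow>
     cocone J C Fo Fa X \<iota> \<and>
     (\<forall>Y \<kappa>. cocone J C Fo Fa Y \<kappa> \<longrightarrow>
        (\<exists>!h. h \<in> homset C X Y \<and> (\<forall>i\<in>Obj J. Comp C h (\<iota> i) = \<kappa> i)))"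

text \<open>The full subcategory of \<open>C\<close> on the set of objects \<open>G\<close> is colimit-dense. Since a small set
  injects into \<open>Pow A\<close> for some \<open>A :: 'u set\<close>, every small category is isomorphic to one whose objects
  and arrows are taken from the type \<open>'u set\<close>, so the type of \<open>J\<close> is no restriction. The colimits are
  formed in \<open>C\<close>, not in the subcategory.\<close>

definition colimit_dense :: "('u set \<Rightarrow> bool) \<Rightarrow> ('o, 'm) category \<Rightarrow> 'o set \<Rightarrow> bool" where
  "colimit_dense S C G \<longleftrightarrow>
     G \<subseteq> Obj C \<and> small_cat S (full_subcat C G) \<and>
     (\<forall>X\<in>Obj C. \<exists>(J :: ('u set, 'u set) category) Fo Fa \<iota>.
        is_category J \<and> small_cat S J \<and> diagram J (full_subcat C G) Fo Fa \<and>
        is_colimit J C Fo Fa X \<iota>)"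


section \<open>The category of vector spaces\<close>

text \<open>Arrows are triples (domain, map, codomain), with the map taken to be \<^term>\<open>undefined\<close> off the
  carrier of the domain.\<close>

type_synonym ('k, 'u) vec_arr = "('k, 'u) module \<times> ('u \<Rightarrow> 'u) \<times> ('k, 'u) module"

definition Vec ::
  "('u set \<Rightarrow> bool) \<Rightarrow> 'k ring \<Rightarrow> (('k, 'u) module, ('k, 'u) vec_arr) category" where
  "Vec S K =
    \<lparr>Obj = {V. vectorspace K V \<and> S (carrier V)},
     Arr = {(V, f, W). vectorspace K V \<and> S (carrier V) \<and> vectorspace K W \<and> S (carrier W) \<and>
                       f \<in> module_hom K V W \<and> f \<in> extensional (carrier V)},
     Dom = (\<lambda>(V, f, W). V),
     Cod = (\<lambda>(V, f, W). W),
     Ident = (\<lambda>V. (V, restrict id (carrier V), V)),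
     Comp = (\<lambda>(V', g, W') (V, f, W). (V, compose (carrier V) g f, W'))\<rparr>"

definition countable_dim :: "'k ring \<Rightarrow> ('k, 'u) module \<Rightarrow> bool" where
  "countable_dim K V \<longleftrightarrow> (\<exists>B. vectorspace.basis K V B \<and> countable B)"

lemma is_category_Vec:
  fixes K :: "'k ring" and S :: "'u set \<Rightarrow> bool"
  shows "is_category (Vec S K)"
proof -
  have id: "restrict id (carrier V) \<in> module_hom K V V" if "vectorspace K V" for V :: "('k, 'u) module"
  proof -
    interpret vectorspace K V by fact
    show ?thesis by (auto simp: module_hom_def)
  qed
  have comp: "compose (carrier U) g f \<in> module_hom K U W"
    if "vectorspace K U" "f \<in> module_hom K U V" "g \<in> module_hom K V W"
    for U V W :: "('k, 'u) module" and f g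
  proof -
    interpret vectorspace K U by fact
    show ?thesis using that(2,3) by (auto simp: module_hom_def compose_def Pi_iff)
  qed
  have c1: "compose (carrier V) f (restrict id (carrier V)) = f"
    if "f \<in> extensional (carrier V)" for V :: "('k, 'u) module" and f :: "'u \<Rightarrow> 'u"
    using that by (auto simp: compose_def extensional_def)
  have c2: "compose (carrier V) (restrict id (carrier W)) f = f"
    if "f \<in> extensional (carrier V)" "f \<in> module_hom K V W" for V W :: "('k, 'u) module" and f
    using that by (auto simp: compose_def extensional_def module_hom_def Pi_iff)
  have c3: "compose (carrier U) h (compose (carrier U) g f)
      = compose (carrier U) (compose (carrier V) h g) f"
    if "f \<in> module_hom K U V" for U V :: "('k, 'u) module" and f and g h :: "'u \<Rightarrow> 'u"
    using that by (auto simp: compose_def module_hom_def Pi_iff)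
  show ?thesis
    unfolding is_category_def
    by (auto simp: Vec_def homset_def id comp c1 c2 c3)
qed

end

theory Submission
  imports Defs
begin

text \<open>
  Let \<open>V\<close> be a vector space with basis \<open>B\<close>, that is, the space of finitely supported families of
  scalars on \<open>B\<close>. A family on \<open>B\<close> has finite support as soon as its restriction to every countable
  subset of \<open>B\<close> has finite support, because an infinite support would contain a countably infinite
  set. Hence \<open>V\<close> is the limit, over the countable subsets \<open>C\<close> of \<open>B\<close> ordered by inclusion, of the
  spaces of finitely supported families on \<open>C\<close>, with the restriction maps as transition maps. This
  is \<open>countable_amalgamation\<close>, in which the restriction maps appear as the projections of \<open>V\<close> onto
  the spans of the sets \<open>C\<close>; each of them factors through a space of countable dimension in the
  given representative set (\<open>proj_factors_through_representative\<close>), and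
  \<open>is_colimit_of_countable_projections\<close> turns this into a colimit in the opposite category. The
  index category is small because its objects are subsets of the small set \<open>B\<close>.

  It remains to see that the full subcategory of the representatives is small
  (\<open>small_cat_representatives\<close>). There are only countably many representatives, since the dimension
  determines a space up to isomorphism, and an arrow between two of them is given by a countable
  matrix of scalars. If some representative is nonzero, then the field embeds into its small
  carrier, so that the matrices form a small set; otherwise all the matrices are empty.
\<close>

section \<open>Closure properties of small sets\<close>

context
  includes cardinal_syntax
begin

lemma lepoll_card_of: "A \<lesssim> B \<longleftrightarrow> |A| \<le>o |B|"
  unfolding lepoll_def card_of_ordLeq by simp

lemma lepoll_linear: "A \<lesssim> B \<or> B \<lesssim> A"
  unfolding lepoll_card_of by (intro ordLeq_total card_of_Well_order)

lemma times_lepoll_infinite: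
  assumes "infinite C" "A \<lesssim> C" "B \<lesssim> C"
  shows "A \<times> B \<lesssim> C"
proof -
  have "|C \<times> C| =o |C|" by (rule card_of_Times_same_infinite) fact
  then have "C \<times> C \<lesssim> C" unfolding lepoll_card_of ordIso_iff_ordLeq by (rule conjunct1)
  with times_lepoll_mono [OF assms(2,3)] show ?thesis by (rule lepoll_trans)
qed

lemma plus_lepoll_infinite:
  assumes "infinite C"
  shows "C <+> C \<lesssim> C"
proof -
  have "|C <+> C| =o |C|" by (rule card_of_Plus_infinite1 [OF assms card_of_mono1]) simp
  then show ?thesis unfolding lepoll_card_of ordIso_iff_ordLeq by (rule conjunct1)
qed

end

lemma Pow_lepoll_mono:
  assumes "A \<lesssim> B"
  shows "Pow A \<lesssim> Pow B"
proof -
  obtain f where "inj_on f A" "f ` A \<subseteq> B" using assms by (auto simp: lepoll_def)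
  then have "inj_on (image f) (Pow A)" "image f ` Pow A \<subseteq> Pow B"
    by (auto intro: inj_on_image_Pow)
  then show ?thesis unfolding lepoll_def by blast
qed

lemma smallI: "S A \<Longrightarrow> X \<lesssim> Pow A \<Longrightarrow> small S X"
  by (auto simp: small_def)

lemma lepoll_small: "X \<lesssim> Y \<Longrightarrow> small S Y \<Longrightarrow> small S X"
  unfolding small_def using lepoll_trans [of X Y] by blast

lemma small_subset: "X \<subseteq> Y \<Longrightarrow> small S Y \<Longrightarrow> small S X"
  by (rule lepoll_small [OF subset_imp_lepoll])

lemma universe_infinite: "universe S \<Longrightarrow> \<exists>N. infinite N \<and> S N"
  by (simp add: universe_def)

lemma universe_subset:
  assumes "universe S" "S A" "B \<subseteq> A"
  shows "S B"
proof -
  have "B \<lesssim> Pow A" using assms(3) by (rule lepoll_trans [OF subset_imp_lepoll lepoll_Pow_self])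
  with assms(2) have "small S B" by (rule smallI)
  then show ?thesis
    by (rule assms(1) [unfolded universe_def, THEN conjunct1, rule_format])
qed

lemma universe_common_bound:
  assumes "universe S" "S A" "S B"
  obtains C where "infinite C" "S C" "A \<lesssim> C" "B \<lesssim> C"
proof -
  obtain N where N: "infinite N" "S N" using universe_infinite [OF assms(1)] by blast
  define D where "D = (if A \<lesssim> B then B else A)"
  have D: "S D" "A \<lesssim> D" "B \<lesssim> D" using assms(2,3) lepoll_linear [of A B] by (auto simp: D_def)
  define C where "C = (if D \<lesssim> N then N else D)"
  have C: "S C" "D \<lesssim> C" "N \<lesssim> C" using D N lepoll_linear [of D N] by (auto simp: C_def)
  have "infinite C" using lepoll_trans [OF _ C(3), of "UNIV :: nat set"] N(1)
    by (simp add: infinite_le_lepoll)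
  then show ?thesis
    using C(1) lepoll_trans [OF D(2) C(2)] lepoll_trans [OF D(3) C(2)] by (rule that)
qed

lemma small_Times:
  assumes "universe S" "small S X" "small S Y"
  shows "small S (X \<times> Y)"
proof -
  obtain A B where AB: "S A" "X \<lesssim> Pow A" "S B" "Y \<lesssim> Pow B"
    using assms(2,3) by (auto simp: small_def)
  obtain C where C: "infinite C" "S C" "A \<lesssim> C" "B \<lesssim> C"
    by (rule universe_common_bound [OF assms(1) AB(1,3)])
  have "X \<lesssim> Pow C" "Y \<lesssim> Pow C"
    using lepoll_trans [OF AB(2) Pow_lepoll_mono] lepoll_trans [OF AB(4) Pow_lepoll_mono] C(3,4)
    by blast+
  then have "X \<times> Y \<lesssim> Pow C \<times> Pow C" by (rule times_lepoll_mono)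
  also have "Pow C \<times> Pow C \<lesssim> Pow (C <+> C)"
  proof -
    have "inj_on (\<lambda>(P, Q). Inl ` P \<union> Inr ` Q) (Pow C \<times> Pow C)"
      by (rule inj_onI) blast
    moreover have "(\<lambda>(P, Q). Inl ` P \<union> Inr ` Q) ` (Pow C \<times> Pow C) \<subseteq> Pow (C <+> C)"
      by auto
    ultimately show ?thesis unfolding lepoll_def by blast
  qed
  also have "Pow (C <+> C) \<lesssim> Pow C"
    by (rule Pow_lepoll_mono [OF plus_lepoll_infinite [OF C(1)]])
  finally have "X \<times> Y \<lesssim> Pow C" .
  with C(2) show ?thesis by (rule smallI)
qed

lemma small_countable:
  assumes "universe S" "countable X"
  shows "small S X"
proof -
  obtain N where N: "infinite N" "S N" using universe_infinite [OF assms(1)] by blast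
  have "X \<lesssim> (UNIV :: nat set)"
    using assms(2) unfolding countable_def lepoll_def by simp
  also have "(UNIV :: nat set) \<lesssim> N" using N(1) by (simp add: infinite_le_lepoll)
  also have "N \<lesssim> Pow N" by (rule lepoll_Pow_self)
  finally have "X \<lesssim> Pow N" .
  with N(2) show ?thesis by (rule smallI)
qed

text \<open>This needs \<open>X\<close> to be bounded by a member of the universe: for a set that is only small,
  the power set may be too large.\<close>

lemma small_Pow_countable_Times:
  assumes "universe S" "countable M" "X \<lesssim> A" "S A"
  shows "small S (Pow (M \<times> X))"
proof -
  obtain C where C: "infinite C" "S C" "A \<lesssim> C"
    by (rule universe_common_bound [OF assms(1,4,4)])
  have "M \<lesssim> (UNIV :: nat set)"
    using assms(2) unfolding countable_def lepoll_def by simp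
  also have "(UNIV :: nat set) \<lesssim> C" using C(1) by (simp add: infinite_le_lepoll)
  finally have "M \<lesssim> C" .
  then have "M \<times> X \<lesssim> C" using C(1) lepoll_trans [OF assms(3) C(3)] by (intro times_lepoll_infinite)
  then have "Pow (M \<times> X) \<lesssim> Pow C" by (rule Pow_lepoll_mono)
  with C(2) show ?thesis by (rule smallI)
qed

section \<open>Coordinates with respect to a basis\<close>

context vectorspace
begin

text \<open>The finitely supported families of scalars on \<open>B\<close>. They are represented by functions on
  the whole type that vanish off \<open>B\<close>, so that equality of coordinates is equality of functions.\<close>

definition fin_coeffs :: "'c set \<Rightarrow> ('c \<Rightarrow> 'a) set" where
  "fin_coeffs B = {a. range a \<subseteq> carrier K \<and> finite {b. a b \<noteq> \<zero>\<^bsub>K\<^esub>} \<and> {b. a b \<noteq> \<zero>\<^bsub>K\<^esub>} \<subseteq> B}"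

text \<open>The linear combination with a given family of coefficients.\<close>

definition comb :: "('c \<Rightarrow> 'a) \<Rightarrow> 'c" where
  "comb a = lincomb a {b. a b \<noteq> \<zero>\<^bsub>K\<^esub>}"

text \<open>The family of coordinates of \<open>v\<close> with respect to a basis \<open>B\<close>, which may be infinite.\<close>

definition coord :: "'c set \<Rightarrow> 'c \<Rightarrow> 'c \<Rightarrow> 'a" where
  "coord B v = (THE a. a \<in> fin_coeffs B \<and> comb a = v)"

lemma fin_coeffsD:
  assumes "a \<in> fin_coeffs B"
  shows "a b \<in> carrier K" "b \<notin> B \<Longrightarrow> a b = \<zero>\<^bsub>K\<^esub>"
  using assms unfolding fin_coeffs_def by auto

lemma comb_eq_lincomb:
  assumes "range a \<subseteq> carrier K" "finite F" "F \<subseteq> carrier V" "{b. a b \<noteq> \<zero>\<^bsub>K\<^esub>} \<subseteq> F"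
  shows "comb a = lincomb a F"
  unfolding comb_def lincomb_def
  by (rule M.add.finprod_mono_neutral_cong_left) (use assms in auto)

lemma comb_closed:
  assumes "a \<in> fin_coeffs B" "B \<subseteq> carrier V"
  shows "comb a \<in> carrier V"
  unfolding comb_def
  by (rule lincomb_closed) (use assms in \<open>auto simp: fin_coeffs_def\<close>)

lemma comb_in_span:
  assumes "a \<in> fin_coeffs B"
  shows "comb a \<in> span B"
  unfolding comb_def span_def
  by (intro CollectI exI conjI refl) (use assms in \<open>auto simp: fin_coeffs_def\<close>)

lemma comb_inj:
  assumes B: "lin_indpt B" "B \<subseteq> carrier V"
    and a: "a \<in> fin_coeffs B" "a' \<in> fin_coeffs B" and eq: "comb a = comb a'"
  shows "a = a'"
proof (rule ccontr)
  assume "a \<noteq> a'"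
  then obtain b where b: "a b \<noteq> a' b" by blast
  define F where "F = {b. a b \<noteq> \<zero>\<^bsub>K\<^esub>} \<union> {b. a' b \<noteq> \<zero>\<^bsub>K\<^esub>}"
  have F: "finite F" "F \<subseteq> B" using a by (auto simp: F_def fin_coeffs_def)
  have r: "range a \<subseteq> carrier K" "range a' \<subseteq> carrier K" using a by (auto simp: fin_coeffs_def)
  have "lincomb (\<lambda>v. a v \<ominus>\<^bsub>K\<^esub> a' v) F = lincomb a F \<ominus>\<^bsub>V\<^esub> lincomb a' F"
    by (rule lincomb_diff) (use F B r in auto)
  also have "lincomb a F = comb a"
    by (rule comb_eq_lincomb [symmetric]) (use F B r in \<open>auto simp: F_def\<close>)
  also have "lincomb a' F = comb a'"
    by (rule comb_eq_lincomb [symmetric]) (use F B r in \<open>auto simp: F_def\<close>)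
  also have "comb a \<ominus>\<^bsub>V\<^esub> comb a' = \<zero>\<^bsub>V\<^esub>"
    using eq comb_closed [OF a(2) B(2)] by (simp add: M.r_neg a_minus_def)
  finally have z: "lincomb (\<lambda>v. a v \<ominus>\<^bsub>K\<^esub> a' v) F = \<zero>\<^bsub>V\<^esub>" .
  have "b \<in> F" using b by (auto simp: F_def)
  moreover have "a b \<ominus>\<^bsub>K\<^esub> a' b \<noteq> \<zero>\<^bsub>K\<^esub>"
  proof
    assume "a b \<ominus>\<^bsub>K\<^esub> a' b = \<zero>\<^bsub>K\<^esub>"
    moreover have "a b = (a b \<ominus>\<^bsub>K\<^esub> a' b) \<oplus>\<^bsub>K\<^esub> a' b"
      using r by (simp add: a_minus_def R.add.m_assoc R.l_neg image_subset_iff)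
    ultimately show False using b r by (simp add: image_subset_iff)
  qed
  ultimately have "lin_dep B"
    by (intro lin_dep_crit [OF F, of "\<lambda>v. a v \<ominus>\<^bsub>K\<^esub> a' v" b]) (use r z in \<open>auto simp: image_subset_iff\<close>)
  with B show False by blast
qed

lemma comb_surj:
  assumes B: "basis B" and v: "v \<in> carrier V"
  shows "\<exists>a \<in> fin_coeffs B. comb a = v"
proof -
  have "v \<in> span B" "B \<subseteq> carrier V" using assms by (auto simp: basis_def)
  then obtain a A where A: "finite A" "A \<subseteq> B" "a \<in> A \<rightarrow> carrier K" "v = lincomb a A"
    by (auto simp: span_def)
  define a' where "a' = (\<lambda>b. if b \<in> A then a b else \<zero>\<^bsub>K\<^esub>)"
  have r: "range a' \<subseteq> carrier K" using A by (auto simp: a'_def)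
  have sup: "{b. a' b \<noteq> \<zero>\<^bsub>K\<^esub>} \<subseteq> A" by (auto simp: a'_def)
  have "comb a' = lincomb a' A"
    by (rule comb_eq_lincomb) (use r sup A \<open>B \<subseteq> carrier V\<close> in auto)
  also have "\<dots> = lincomb a A"
    by (rule lincomb_cong) (use A \<open>B \<subseteq> carrier V\<close> in \<open>auto simp: a'_def\<close>)
  finally have "comb a' = v" using A by simp
  moreover have "a' \<in> fin_coeffs B"
    using r sup A finite_subset [OF sup] by (auto simp: fin_coeffs_def)
  ultimately show ?thesis by blast
qed

lemma coord_comb:
  assumes "basis B" "a \<in> fin_coeffs B"
  shows "coord B (comb a) = a"
  unfolding coord_def using comb_inj [of B] assms by (auto simp: basis_def)

lemma coord_mem:
  assumes "basis B" "v \<in> carrier V"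
  shows "coord B v \<in> fin_coeffs B"
  using comb_surj [OF assms] coord_comb [OF assms(1)] by auto

lemma comb_coord:
  assumes "basis B" "v \<in> carrier V"
  shows "comb (coord B v) = v"
  using comb_surj [OF assms] coord_comb [OF assms(1)] by auto

lemma coord_inject:
  assumes "basis B" "v \<in> carrier V" "w \<in> carrier V" "coord B v = coord B w"
  shows "v = w"
  using comb_coord assms by metis

lemma comb_add:
  assumes a: "a \<in> fin_coeffs B" "a' \<in> fin_coeffs B" and B: "B \<subseteq> carrier V"
  shows "(\<lambda>b. a b \<oplus>\<^bsub>K\<^esub> a' b) \<in> fin_coeffs B"
    and "comb (\<lambda>b. a b \<oplus>\<^bsub>K\<^esub> a' b) = comb a \<oplus>\<^bsub>V\<^esub> comb a'"
proof -
  define F where "F = {b. a b \<noteq> \<zero>\<^bsub>K\<^esub>} \<union> {b. a' b \<noteq> \<zero>\<^bsub>K\<^esub>}"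
  have F: "finite F" "F \<subseteq> B" using a by (auto simp: F_def fin_coeffs_def)
  have r: "range a \<subseteq> carrier K" "range a' \<subseteq> carrier K" using a by (auto simp: fin_coeffs_def)
  have sup: "{b. a b \<oplus>\<^bsub>K\<^esub> a' b \<noteq> \<zero>\<^bsub>K\<^esub>} \<subseteq> F" by (auto simp: F_def)
  have rr: "range (\<lambda>b. a b \<oplus>\<^bsub>K\<^esub> a' b) \<subseteq> carrier K" using r by auto
  show "(\<lambda>b. a b \<oplus>\<^bsub>K\<^esub> a' b) \<in> fin_coeffs B"
    using rr sup F finite_subset [OF sup] by (auto simp: fin_coeffs_def)
  have "comb (\<lambda>b. a b \<oplus>\<^bsub>K\<^esub> a' b) = lincomb (\<lambda>b. a b \<oplus>\<^bsub>K\<^esub> a' b) F"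
    by (rule comb_eq_lincomb) (use F B rr sup in auto)
  also have "\<dots> = lincomb a F \<oplus>\<^bsub>V\<^esub> lincomb a' F"
    by (rule lincomb_sum) (use F B r in auto)
  also have "lincomb a F = comb a"
    by (rule comb_eq_lincomb [symmetric]) (use F B r in \<open>auto simp: F_def\<close>)
  also have "lincomb a' F = comb a'"
    by (rule comb_eq_lincomb [symmetric]) (use F B r in \<open>auto simp: F_def\<close>)
  finally show "comb (\<lambda>b. a b \<oplus>\<^bsub>K\<^esub> a' b) = comb a \<oplus>\<^bsub>V\<^esub> comb a'" .
qed

lemma comb_smult:
  assumes a: "a \<in> fin_coeffs B" and c: "c \<in> carrier K" and B: "B \<subseteq> carrier V"
  shows "(\<lambda>b. c \<otimes>\<^bsub>K\<^esub> a b) \<in> fin_coeffs B"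
    and "comb (\<lambda>b. c \<otimes>\<^bsub>K\<^esub> a b) = c \<odot>\<^bsub>V\<^esub> comb a"
proof -
  define F where "F = {b. a b \<noteq> \<zero>\<^bsub>K\<^esub>}"
  have F: "finite F" "F \<subseteq> B" using a by (auto simp: F_def fin_coeffs_def)
  have r: "range a \<subseteq> carrier K" using a by (auto simp: fin_coeffs_def)
  have sup: "{b. c \<otimes>\<^bsub>K\<^esub> a b \<noteq> \<zero>\<^bsub>K\<^esub>} \<subseteq> F" using c by (auto simp: F_def)
  have rr: "range (\<lambda>b. c \<otimes>\<^bsub>K\<^esub> a b) \<subseteq> carrier K" using r c by auto
  show "(\<lambda>b. c \<otimes>\<^bsub>K\<^esub> a b) \<in> fin_coeffs B"
    using rr sup F finite_subset [OF sup] by (auto simp: fin_coeffs_def)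
  have "comb (\<lambda>b. c \<otimes>\<^bsub>K\<^esub> a b) = lincomb (\<lambda>b. c \<otimes>\<^bsub>K\<^esub> a b) F"
    by (rule comb_eq_lincomb) (use F B rr sup in auto)
  also have "\<dots> = c \<odot>\<^bsub>V\<^esub> lincomb a F"
    by (rule lincomb_smult) (use F B r c in auto)
  finally show "comb (\<lambda>b. c \<otimes>\<^bsub>K\<^esub> a b) = c \<odot>\<^bsub>V\<^esub> comb a"
    by (simp add: F_def comb_def)
qed

lemma coord_add:
  assumes B: "basis B" and v: "v \<in> carrier V" "w \<in> carrier V"
  shows "coord B (v \<oplus>\<^bsub>V\<^esub> w) b = coord B v b \<oplus>\<^bsub>K\<^esub> coord B w b"
proof -
  have "B \<subseteq> carrier V" using B by (simp add: basis_def)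
  note * = comb_add [OF coord_mem [OF B v(1)] coord_mem [OF B v(2)] this]
  show ?thesis using coord_comb [OF B *(1)] *(2) by (simp add: comb_coord B v)
qed

lemma coord_smult:
  assumes B: "basis B" and v: "v \<in> carrier V" and c: "c \<in> carrier K"
  shows "coord B (c \<odot>\<^bsub>V\<^esub> v) b = c \<otimes>\<^bsub>K\<^esub> coord B v b"
proof -
  have "B \<subseteq> carrier V" using B by (simp add: basis_def)
  note * = comb_smult [OF coord_mem [OF B v] c this]
  show ?thesis using coord_comb [OF B *(1)] *(2) by (simp add: comb_coord B v)
qed

lemma coord_basis:
  assumes B: "basis B" and b: "b \<in> B"
  shows "coord B b = (\<lambda>b'. if b' = b then \<one>\<^bsub>K\<^esub> else \<zero>\<^bsub>K\<^esub>)"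
proof -
  let ?d = "\<lambda>b'. if b' = b then \<one>\<^bsub>K\<^esub> else \<zero>\<^bsub>K\<^esub>"
  have bc: "b \<in> carrier V" using B b by (auto simp: basis_def)
  have "comb ?d = lincomb ?d {b}"
    by (rule comb_eq_lincomb) (use bc in auto)
  also have "\<dots> = b" using bc by (simp add: lincomb_def)
  finally have "comb ?d = b" .
  moreover have "?d \<in> fin_coeffs B" using b by (auto simp: fin_coeffs_def)
  ultimately show ?thesis using coord_comb [OF B] by metis
qed

text \<open>Zorn's lemma applies because linear dependence is witnessed by finitely many vectors, which
  all lie in one member of a chain.\<close>

lemma basis_exists: "\<exists>B. basis B"
proof -
  let ?I = "{A. A \<subseteq> carrier V \<and> lin_indpt A}"
  have "\<exists>U\<in>?I. \<forall>X\<in>C. X \<subseteq> U" if C: "subset.chain ?I C" for C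
  proof (intro bexI ballI)
    have "lin_indpt (\<Union>C)"
    proof
      assume "lin_dep (\<Union>C)"
      then obtain A a v where A: "finite A" "A \<subseteq> \<Union>C" "a \<in> A \<rightarrow> carrier K"
        "lincomb a A = \<zero>\<^bsub>V\<^esub>" "v \<in> A" "a v \<noteq> \<zero>\<^bsub>K\<^esub>"
        by (auto simp: lin_dep_def)
      then have "C \<noteq> {}" by auto
      then obtain X where "X \<in> C" "A \<subseteq> X"
        using finite_subset_Union_chain [OF A(1,2) _ C] by blast
      then have "lin_dep X" using A by (auto simp: lin_dep_def)
      then show False using C \<open>X \<in> C\<close> by (auto simp: subset.chain_def)
    qed
    then show "\<Union>C \<in> ?I" using C by (auto simp: subset.chain_def)
  qed auto
  from subset_Zorn [OF this] obtain M where "M \<in> ?I" "\<forall>X\<in>?I. M \<subseteq> X \<longrightarrow> X = M"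
    by blast
  then have "maximal M (\<lambda>S. S \<subseteq> carrier V \<and> lin_indpt S)"
    by (auto simp: maximal_def)
  then show ?thesis using max_li_is_basis by blast
qed

end

text \<open>The equalizer of two linear maps is a subspace.\<close>

lemma module_hom_eq_on_basis:
  assumes V: "vectorspace K V" and W: "vectorspace K W" and B: "vectorspace.basis K V B"
    and f: "f \<in> module_hom K V W" and g: "g \<in> module_hom K V W"
    and eq: "\<And>b. b \<in> B \<Longrightarrow> f b = g b" and v: "v \<in> carrier V"
  shows "f v = g v"
proof -
  interpret V: vectorspace K V by fact
  interpret W: vectorspace K W by fact
  interpret f: mod_hom K V W f by unfold_locales fact
  interpret g: mod_hom K V W g by unfold_locales fact
  have "submodule K {v \<in> carrier V. f v = g v} V"
    by unfold_locales auto
  moreover have "B \<subseteq> {v \<in> carrier V. f v = g v}" using B eq by (auto simp: V.basis_def)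
  ultimately have "V.span B \<subseteq> {v \<in> carrier V. f v = g v}" using V.span_is_subset by blast
  then show ?thesis using v B by (auto simp: V.basis_def)
qed

section \<open>Coordinate projections and amalgamation\<close>

text \<open>Let \<open>B\<close> be a basis of \<open>V\<close> and \<open>D\<close> a subset of a basis of \<open>W\<close>. A map \<open>\<sigma>\<close> defined on \<open>D\<close>
  pulls families of coordinates back; if \<open>\<sigma>\<close> is injective on \<open>D\<close>, finite supports are preserved and
  the pullback is a linear map from \<open>V\<close> to \<open>W\<close>. Coordinate projections and the isomorphisms between
  spaces of the same dimension both have this form.\<close>

definition reindex ::
  "('a, 'b) ring_scheme \<Rightarrow> ('a, 'c, 'd) module_scheme \<Rightarrow> 'c set \<Rightarrow> ('a, 'e, 'f) module_scheme \<Rightarrow>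
    'e set \<Rightarrow> ('e \<Rightarrow> 'c) \<Rightarrow> 'c \<Rightarrow> 'e" where
  "reindex K V B W D \<sigma> v =
    vectorspace.comb K W (\<lambda>b. if b \<in> D then vectorspace.coord K V B v (\<sigma> b) else \<zero>\<^bsub>K\<^esub>)"

lemma
  assumes V: "vectorspace K V" and W: "vectorspace K W"
    and B: "vectorspace.basis K V B" and B': "vectorspace.basis K W B'"
    and D: "D \<subseteq> B'" and \<sigma>: "inj_on \<sigma> D"
  shows coord_reindex: "v \<in> carrier V \<Longrightarrow>
      vectorspace.coord K W B' (reindex K V B W D \<sigma> v) =
        (\<lambda>b. if b \<in> D then vectorspace.coord K V B v (\<sigma> b) else \<zero>\<^bsub>K\<^esub>)"
    and reindex_hom: "reindex K V B W D \<sigma> \<in> module_hom K V W"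
    and reindex_in_span: "v \<in> carrier V \<Longrightarrow> reindex K V B W D \<sigma> v \<in> module.span K W D"
proof -
  interpret V: vectorspace K V by fact
  interpret W: vectorspace K W by fact
  have BW: "B' \<subseteq> carrier W" using B' by (simp add: W.basis_def)
  have a: "(\<lambda>b. if b \<in> D then V.coord B v (\<sigma> b) else \<zero>\<^bsub>K\<^esub>) \<in> W.fin_coeffs D"
    (is "?a \<in> _") if "v \<in> carrier V" for v
  proof -
    have c: "V.coord B v \<in> V.fin_coeffs B" by (rule V.coord_mem) fact+
    have "{b. ?a b \<noteq> \<zero>\<^bsub>K\<^esub>} = \<sigma> -` {b. V.coord B v b \<noteq> \<zero>\<^bsub>K\<^esub>} \<inter> D" by auto
    also have "finite \<dots>"
      using c \<sigma> by (intro finite_vimage_IntI) (auto simp: V.fin_coeffs_def)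
    finally have "finite {b. ?a b \<noteq> \<zero>\<^bsub>K\<^esub>}" .
    then show ?thesis using V.fin_coeffsD(1) [OF c] by (auto simp: W.fin_coeffs_def split: if_splits)
  qed
  have mono: "W.fin_coeffs D \<subseteq> W.fin_coeffs B'" using D by (auto simp: W.fin_coeffs_def)
  show c: "W.coord B' (reindex K V B W D \<sigma> v) = (\<lambda>b. if b \<in> D then V.coord B v (\<sigma> b) else \<zero>\<^bsub>K\<^esub>)"
    if "v \<in> carrier V" for v
    unfolding reindex_def by (rule W.coord_comb [OF B']) (use a [OF that] mono in blast)
  show span: "reindex K V B W D \<sigma> v \<in> W.span D" if "v \<in> carrier V" for v
    unfolding reindex_def using a [OF that] by (rule W.comb_in_span)
  have cl: "reindex K V B W D \<sigma> v \<in> carrier W" if "v \<in> carrier V" for v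
    unfolding reindex_def by (rule W.comb_closed [OF _ BW]) (use a [OF that] mono in blast)
  show "reindex K V B W D \<sigma> \<in> module_hom K V W"
    unfolding module_hom_def
  proof (intro CollectI conjI allI impI; (elim conjE)?)
    show "reindex K V B W D \<sigma> \<in> carrier V \<rightarrow> carrier W" using cl by auto
  next
    fix v w assume "v \<in> carrier V" "w \<in> carrier V"
    then show "reindex K V B W D \<sigma> (v \<oplus>\<^bsub>V\<^esub> w) =
        reindex K V B W D \<sigma> v \<oplus>\<^bsub>W\<^esub> reindex K V B W D \<sigma> w"
      by (intro W.coord_inject [OF B'])
         (auto simp: cl c W.coord_add B' V.coord_add B fun_eq_iff)
  next
    fix r v assume "r \<in> carrier K" "v \<in> carrier V"
    then show "reindex K V B W D \<sigma> (r \<odot>\<^bsub>V\<^esub> v) = r \<odot>\<^bsub>W\<^esub> reindex K V B W D \<sigma> v"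
      by (intro W.coord_inject [OF B'])
         (auto simp: cl c W.coord_smult B' V.coord_smult B fun_eq_iff)
  qed
qed

lemma basis_eqpoll_imp_iso:
  assumes V: "vectorspace K V" and W: "vectorspace K W"
    and B: "vectorspace.basis K V B" and B': "vectorspace.basis K W B'" and eq: "B \<approx> B'"
  shows "\<exists>f \<in> module_hom K V W. \<exists>g \<in> module_hom K W V.
    (\<forall>v \<in> carrier V. g (f v) = v) \<and> (\<forall>w \<in> carrier W. f (g w) = w)"
proof -
  interpret V: vectorspace K V by fact
  interpret W: vectorspace K W by fact
  obtain \<tau> where \<tau>: "bij_betw \<tau> B B'" using eq by (auto simp: eqpoll_def)
  define \<sigma> where "\<sigma> = inv_into B \<tau>"
  have \<sigma>: "bij_betw \<sigma> B' B" unfolding \<sigma>_def using \<tau> by (rule bij_betw_inv_into)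
  have \<sigma>\<tau>: "\<sigma> (\<tau> b) = b" if "b \<in> B" for b
    using that \<tau> by (simp add: \<sigma>_def bij_betw_inv_into_left)
  have \<tau>\<sigma>: "\<tau> (\<sigma> b) = b" if "b \<in> B'" for b
    using that \<tau> by (simp add: \<sigma>_def bij_betw_inv_into_right)
  let ?f = "reindex K V B W B' \<sigma>" and ?g = "reindex K W B' V B \<tau>"
  note f = coord_reindex [OF V W B B' subset_refl bij_betw_imp_inj_on [OF \<sigma>]]
    and f_hom = reindex_hom [OF V W B B' subset_refl bij_betw_imp_inj_on [OF \<sigma>]]
    and g = coord_reindex [OF W V B' B subset_refl bij_betw_imp_inj_on [OF \<tau>]]
    and g_hom = reindex_hom [OF W V B' B subset_refl bij_betw_imp_inj_on [OF \<tau>]]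
  have f_cl: "?f v \<in> carrier W" if "v \<in> carrier V" for v
    using module_hom_closed [OF f_hom] that by auto
  have g_cl: "?g v \<in> carrier V" if "v \<in> carrier W" for v
    using module_hom_closed [OF g_hom] that by auto
  have "?g (?f v) = v" if v: "v \<in> carrier V" for v
    by (rule V.coord_inject [OF B])
       (use v V.fin_coeffsD(2) [OF V.coord_mem [OF B v]] bij_betwE [OF \<tau>] in
         \<open>auto simp: f g f_cl g_cl \<sigma>\<tau> fun_eq_iff\<close>)
  moreover have "?f (?g w) = w" if w: "w \<in> carrier W" for w
    by (rule W.coord_inject [OF B'])
       (use w W.fin_coeffsD(2) [OF W.coord_mem [OF B' w]] bij_betwE [OF \<sigma>] in
         \<open>auto simp: f g f_cl g_cl \<tau>\<sigma> fun_eq_iff\<close>)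
  ultimately show ?thesis using f_hom g_hom by blast
qed

context vectorspace
begin

text \<open>The projection of \<open>V\<close> onto the span of \<open>B \<inter> C\<close> along the span of \<open>B - C\<close>, as an
  endomorphism of \<open>V\<close>.\<close>

definition proj :: "'c set \<Rightarrow> 'c set \<Rightarrow> 'c \<Rightarrow> 'c" where
  "proj B C = reindex K V B V (B \<inter> C) id"

context
  fixes B
  assumes B: "basis B"
begin

lemma coord_proj:
  "v \<in> carrier V \<Longrightarrow>
    coord B (proj B C v) = (\<lambda>b. if b \<in> C then coord B v b else \<zero>\<^bsub>K\<^esub>)"
  unfolding proj_def
  using coord_reindex [OF vectorspace_axioms vectorspace_axioms B B, of "B \<inter> C" id v]
    fin_coeffsD(2) [OF coord_mem [OF B]] by auto

lemma proj_hom: "proj B C \<in> module_hom K V V"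
  unfolding proj_def by (rule reindex_hom [OF vectorspace_axioms vectorspace_axioms B B]) auto

lemma proj_closed: "v \<in> carrier V \<Longrightarrow> proj B C v \<in> carrier V"
  using module_hom_closed [OF proj_hom] by auto

lemma proj_in_span: "v \<in> carrier V \<Longrightarrow> proj B C v \<in> span (B \<inter> C)"
  unfolding proj_def by (rule reindex_in_span [OF vectorspace_axioms vectorspace_axioms B B]) auto

end

lemma proj_proj:
  assumes "basis B" "v \<in> carrier V"
  shows "proj B C (proj B D v) = proj B (C \<inter> D) v"
  by (rule coord_inject [OF assms(1)])
     (use assms in \<open>auto simp: proj_closed coord_proj fun_eq_iff\<close>)

lemma proj_superset_support:
  assumes B: "basis B" and v: "v \<in> carrier V" and C: "{b. coord B v b \<noteq> \<zero>\<^bsub>K\<^esub>} \<subseteq> C"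
  shows "proj B C v = v"
proof (rule coord_inject [OF B proj_closed [OF B v] v])
  show "coord B (proj B C v) = coord B v"
  proof
    fix b show "coord B (proj B C v) b = coord B v b"
      using C by (cases "coord B v b = \<zero>\<^bsub>K\<^esub>") (auto simp: coord_proj [OF B v])
  qed
qed

lemma proj_span:
  assumes B: "basis B" and v: "v \<in> span C" and C: "C \<subseteq> B"
  shows "proj B C v = v"
proof -
  have BV: "B \<subseteq> carrier V" using B by (simp add: basis_def)
  interpret p: mod_hom K V V "proj B C" by unfold_locales (rule proj_hom [OF B])
  have "submodule K {v \<in> carrier V. proj B C v = v} V"
    by unfold_locales auto
  moreover have "proj B C b = b" if "b \<in> C" for b
    by (rule proj_superset_support [OF B])
       (use that C BV in \<open>auto simp: coord_basis [OF B] subset_iff split: if_splits\<close>)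
  then have "C \<subseteq> {v \<in> carrier V. proj B C v = v}" using C BV by auto
  ultimately have "span C \<subseteq> {v \<in> carrier V. proj B C v = v}" using span_is_subset by blast
  then show "proj B C v = v" using v by auto
qed

text \<open>The heart of the matter: \<open>V\<close> is the limit of its coordinate subspaces of countable dimension.
  A compatible family determines a coordinate \<open>a b\<close> for every \<open>b\<close> in \<open>B\<close>. If infinitely many of
  them were nonzero, then so would be those in a countably infinite set \<open>C\<close>, and \<open>v C\<close> would have
  infinite support.\<close>

lemma countable_amalgamation:
  assumes B: "basis B"
    and v: "\<And>C. C \<subseteq> B \<Longrightarrow> countable C \<Longrightarrow> v C \<in> carrier V"
    and compat: "\<And>C D. C \<subseteq> D \<Longrightarrow> D \<subseteq> B \<Longrightarrow> countable D \<Longrightarrow> proj B C (v D) = v C"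
  shows "\<exists>!x. x \<in> carrier V \<and> (\<forall>C. C \<subseteq> B \<longrightarrow> countable C \<longrightarrow> proj B C x = v C)"
proof (rule ex_ex1I)
  define a where "a b = coord B (v {b}) b" for b
  have a: "coord B (v C) b = a b" if "C \<subseteq> B" "countable C" "b \<in> C" for C b
  proof -
    have "proj B {b} (v C) = v {b}" by (rule compat) (use that in auto)
    then show ?thesis
      unfolding a_def using fun_cong [OF coord_proj [OF B v [OF that(1,2)], of "{b}"], of b] by simp
  qed
  have out: "coord B (v C) b = \<zero>\<^bsub>K\<^esub>" if "C \<subseteq> B" "countable C" "b \<notin> C" for C b
    using coord_proj [OF B v [OF that(1,2)], of C] compat [of C C] that by (metis subset_refl)
  define F where "F = {b \<in> B. a b \<noteq> \<zero>\<^bsub>K\<^esub>}"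
  have "finite F"
  proof (rule ccontr)
    assume "infinite F"
    then obtain C where C: "countable C" "infinite C" "C \<subseteq> F" by (meson infinite_countable_subset')
    then have CB: "C \<subseteq> B" by (auto simp: F_def)
    have "C \<subseteq> {b. coord B (v C) b \<noteq> \<zero>\<^bsub>K\<^esub>}" using C CB a by (auto simp: F_def)
    moreover have "finite {b. coord B (v C) b \<noteq> \<zero>\<^bsub>K\<^esub>}"
      using coord_mem [OF B v [OF CB C(1)]] by (simp add: fin_coeffs_def)
    ultimately show False using C finite_subset by blast
  qed
  then have F: "F \<subseteq> B" "countable F" by (auto simp: F_def countable_finite)
  show "\<exists>x. x \<in> carrier V \<and> (\<forall>C. C \<subseteq> B \<longrightarrow> countable C \<longrightarrow> proj B C x = v C)"
    \<comment> \<open>The amalgam is the member of the family at the finite set of nonzero coordinates.\<close>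
  proof (intro exI conjI allI impI)
    show "v F \<in> carrier V" using F v by blast
    fix C assume C: "C \<subseteq> B" "countable C"
    show "proj B C (v F) = v C"
    proof (rule coord_inject [OF B])
      show "coord B (proj B C (v F)) = coord B (v C)"
      proof
        fix b
        have "coord B (v F) b = a b" if "b \<in> B"
          using that a [OF F, of b] out [OF F, of b] by (cases "b \<in> F") (auto simp: F_def)
        then show "coord B (proj B C (v F)) b = coord B (v C) b"
          using a [OF C, of b] out [OF C, of b] C by (auto simp: coord_proj [OF B v [OF F]])
      qed
    qed (use v F C proj_closed B in auto)
  qed
  fix x y
  assume x: "x \<in> carrier V \<and> (\<forall>C. C \<subseteq> B \<longrightarrow> countable C \<longrightarrow> proj B C x = v C)"
    and y: "y \<in> carrier V \<and> (\<forall>C. C \<subseteq> B \<longrightarrow> countable C \<longrightarrow> proj B C y = v C)"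
  let ?C = "{b. coord B x b \<noteq> \<zero>\<^bsub>K\<^esub>} \<union> {b. coord B y b \<noteq> \<zero>\<^bsub>K\<^esub>}"
  have C: "?C \<subseteq> B" "countable ?C"
    using x y coord_mem [OF B, of x] coord_mem [OF B, of y]
    by (auto simp: fin_coeffs_def countable_finite)
  have "x = proj B ?C x" using x by (intro proj_superset_support [OF B, symmetric]) auto
  also have "\<dots> = proj B ?C y" using x y C by simp
  also have "\<dots> = y" using y by (intro proj_superset_support [OF B]) auto
  finally show "x = y" .
qed

end

section \<open>Spaces of countable dimension form a small category\<close>

text \<open>The arrow of \<^const>\<open>Vec\<close> given by a map \<open>f\<close> that may take any values off the carrier of \<open>V\<close>.\<close>

definition vec_arr :: "('k, 'u) module \<Rightarrow> ('u \<Rightarrow> 'u) \<Rightarrow> ('k, 'u) module \<Rightarrow> ('k, 'u) vec_arr" where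
  "vec_arr V f W = (V, restrict f (carrier V), W)"

lemma module_hom_restrict:
  assumes "module K V"
  shows "restrict f (carrier V) \<in> module_hom K V W \<longleftrightarrow> f \<in> module_hom K V W"
proof -
  interpret module K V by fact
  show ?thesis by (auto simp: module_hom_def Pi_iff)
qed

lemma homset_Vec:
  assumes "V \<in> Obj (Vec S K)" "W \<in> Obj (Vec S K)"
  shows "homset (Vec S K) V W = (\<lambda>f. vec_arr V f W) ` module_hom K V W"
proof (rule equalityI; rule subsetI)
  have V: "module K V" using assms by (auto simp: Vec_def vectorspace_def)
  fix x
  { assume "x \<in> homset (Vec S K) V W"
    then obtain f where "x = (V, f, W)" "f \<in> module_hom K V W" "f \<in> extensional (carrier V)"
      by (auto simp: homset_def Vec_def)
    then show "x \<in> (\<lambda>f. vec_arr V f W) ` module_hom K V W"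
      by (auto simp: vec_arr_def extensional_restrict intro!: image_eqI [of _ _ f]) }
  { assume "x \<in> (\<lambda>f. vec_arr V f W) ` module_hom K V W"
    then show "x \<in> homset (Vec S K) V W"
      using assms by (auto simp: homset_def Vec_def vec_arr_def module_hom_restrict [OF V]) }
qed

lemma vec_arr_eq_iff: "vec_arr V f W = vec_arr V g W \<longleftrightarrow> (\<forall>v \<in> carrier V. f v = g v)"
  by (auto simp: vec_arr_def restrict_def fun_eq_iff split: if_splits)

lemma Comp_vec_arr:
  assumes "f \<in> carrier U \<rightarrow> carrier V"
  shows "Comp (Vec S K) (vec_arr V g W) (vec_arr U f V) = vec_arr U (g \<circ> f) W"
  using assms by (auto simp: Vec_def vec_arr_def compose_def restrict_def fun_eq_iff)

lemma Ident_Vec: "Ident (Vec S K) V = vec_arr V id V"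
  by (simp add: Vec_def vec_arr_def)

lemma isomorphic_Vec_iff:
  assumes V: "V \<in> Obj (Vec S K)" and W: "W \<in> Obj (Vec S K)"
  shows "isomorphic (Vec S K) V W \<longleftrightarrow>
    (\<exists>f \<in> module_hom K V W. \<exists>g \<in> module_hom K W V.
      (\<forall>v \<in> carrier V. g (f v) = v) \<and> (\<forall>w \<in> carrier W. f (g w) = w))"
  unfolding isomorphic_def homset_Vec [OF V W] homset_Vec [OF W V]
  by (simp add: Ident_Vec Comp_vec_arr vec_arr_eq_iff module_hom_closed cong: bex_cong)

text \<open>The field is not assumed to be small; but if it is not, then all spaces in
  \<^const>\<open>Vec\<close> are zero.\<close>

lemma coefficients_lepoll_carrier:
  assumes V: "vectorspace K V" and B: "vectorspace.basis K V B" and b: "b \<in> B"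
  shows "carrier K \<lesssim> carrier V"
proof -
  interpret vectorspace K V by fact
  have bV: "b \<in> carrier V" using B b by (auto simp: basis_def)
  have "inj_on (\<lambda>x. x \<odot>\<^bsub>V\<^esub> b) (carrier K)"
    by (rule inj_on_inverseI [where g = "\<lambda>v. coord B v b"])
       (use bV b in \<open>simp add: coord_smult [OF B] coord_basis [OF B]\<close>)
  moreover have "(\<lambda>x. x \<odot>\<^bsub>V\<^esub> b) ` carrier K \<subseteq> carrier V" using bV by auto
  ultimately show ?thesis unfolding lepoll_def by blast
qed

lemma countable_eqpollI:
  assumes "countable A" "countable B" "finite A \<longleftrightarrow> finite B" "card A = card B"
  shows "A \<approx> B"
proof (cases "finite A")
  case True
  then show ?thesis using assms by (simp add: eqpoll_iff_card)
next
  case False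
  then have "A \<approx> (UNIV :: nat set)" "B \<approx> (UNIV :: nat set)"
    using assms(1-3) to_nat_on_infinite unfolding eqpoll_def by blast+
  then show ?thesis by (rule eqpoll_trans [OF _ eqpoll_sym])
qed

text \<open>A space of countable dimension is determined up to isomorphism by its dimension, that is, by
  whether its bases are finite and, if they are, by their cardinality.\<close>

lemma countable_representatives:
  assumes R: "representative_set (Vec S K) {V \<in> Obj (Vec S K). countable_dim K V} R"
  shows "countable R"
proof -
  have RO: "V \<in> Obj (Vec S K)" "vectorspace K V" if "V \<in> R" for V
    using R that by (auto simp: representative_set_def Vec_def)
  have "\<forall>V\<in>R. \<exists>B. vectorspace.basis K V B \<and> countable B"
    using R by (auto simp: representative_set_def countable_dim_def)
  then obtain B where B: "\<And>V. V \<in> R \<Longrightarrow> vectorspace.basis K V (B V)" "\<And>V. V \<in> R \<Longrightarrow> countable (B V)"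
    by metis
  have "inj_on (\<lambda>V. (finite (B V), card (B V))) R"
  proof (rule inj_onI)
    fix V W assume VW: "V \<in> R" "W \<in> R" "(finite (B V), card (B V)) = (finite (B W), card (B W))"
    then have "B V \<approx> B W" by (intro countable_eqpollI) (auto simp: B)
    then have "isomorphic (Vec S K) V W"
      unfolding isomorphic_Vec_iff [OF RO(1) [OF VW(1)] RO(1) [OF VW(2)]]
      using VW \<open>B V \<approx> B W\<close> by (intro basis_eqpoll_imp_iso [OF RO(2) RO(2) B(1) B(1)])
    moreover have "isomorphic (Vec S K) V V"
      unfolding isomorphic_Vec_iff [OF RO(1) [OF VW(1)] RO(1) [OF VW(1)]]
      using VW(1) by (intro basis_eqpoll_imp_iso [OF RO(2) RO(2) B(1) B(1) eqpoll_refl])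
    ultimately show "V = W" using R VW unfolding representative_set_def by blast
  qed
  then show ?thesis by (rule countable_image_inj_on [rotated]) simp
qed

text \<open>An arrow between two representatives is determined by its matrix with respect to countable
  bases. The graph of a matrix is a subset of a product of a countable set with the field,
  whence the arrows form a small set.\<close>

lemma small_cat_representatives:
  assumes S: "universe S"
    and R: "representative_set (Vec S K) {V \<in> Obj (Vec S K). countable_dim K V} R"
  shows "small_cat S (full_subcat (op_cat (Vec S K)) R)"
proof -
  have cR: "countable R" by (rule countable_representatives) fact
  have RO: "V \<in> Obj (Vec S K)" "vectorspace K V" "S (carrier V)" if "V \<in> R" for V
    using R that by (auto simp: representative_set_def Vec_def)
  have "\<forall>V\<in>R. \<exists>B. vectorspace.basis K V B \<and> countable B"
    using R by (auto simp: representative_set_def countable_dim_def)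
  then obtain B where B: "\<And>V. V \<in> R \<Longrightarrow> vectorspace.basis K V (B V)" "\<And>V. V \<in> R \<Longrightarrow> countable (B V)"
    by metis
  \<comment> \<open>If all the representatives are zero, matrices have no entries and the field plays no role.\<close>
  define X where "X = (if \<exists>V\<in>R. B V \<noteq> {} then carrier K else {})"
  obtain A where A: "X \<lesssim> A" "S A"
  proof (cases "\<exists>V\<in>R. B V \<noteq> {}")
    case True
    then obtain V b where V: "V \<in> R" "b \<in> B V" by blast
    then have "X \<lesssim> carrier V"
      using coefficients_lepoll_carrier [OF RO(2) B(1)] True by (simp add: X_def)
    with V RO that show ?thesis by blast
  next
    case False
    then show ?thesis using S that unfolding universe_def X_def by auto
  qed
  \<comment> \<open>The graph of the matrix, with basis vectors replaced by their positions in fixed enumerations.\<close>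
  define mat where "mat V f W = {((m, n), x). \<exists>b\<in>B V. \<exists>c\<in>B W.
     m = to_nat_on (B V) b \<and> n = to_nat_on (B W) c \<and> x = vectorspace.coord K W (B W) (f b) c}"
    for V W f
  have mat_mem: "mat V f W \<in> Pow (UNIV \<times> X)"
    if "V \<in> R" "W \<in> R" and f: "f \<in> module_hom K V W" for V f W
  proof -
    interpret V: vectorspace K V using RO that by blast
    interpret W: vectorspace K W using RO that by blast
    have "W.coord (B W) (f b) c \<in> X" if b: "b \<in> B V" "c \<in> B W" for b c
    proof -
      have "f b \<in> carrier W"
        using b B(1) [OF \<open>V \<in> R\<close>] module_hom_closed [OF f] by (auto simp: V.basis_def)
      then have "W.coord (B W) (f b) c \<in> carrier K"
        using W.fin_coeffsD(1) W.coord_mem B(1) \<open>W \<in> R\<close> by blast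
      then show ?thesis using b \<open>V \<in> R\<close> by (auto simp: X_def)
    qed
    then show ?thesis unfolding mat_def by blast
  qed
  have mat_inj: "f v = g v"
    if VW: "V \<in> R" "W \<in> R" and fg: "f \<in> module_hom K V W" "g \<in> module_hom K V W"
      and eq: "mat V f W = mat V g W" and v: "v \<in> carrier V" for V f g W v
  proof (rule module_hom_eq_on_basis [OF RO(2) [OF VW(1)] RO(2) [OF VW(2)] B(1) [OF VW(1)] fg _ v])
    interpret V: vectorspace K V using RO that by blast
    interpret W: vectorspace K W using RO that by blast
    fix b assume b: "b \<in> B V"
    then have bV: "b \<in> carrier V" using B(1) [OF VW(1)] by (auto simp: V.basis_def)
    then have cl: "f b \<in> carrier W" "g b \<in> carrier W" using fg module_hom_closed by blast+
    have "W.coord (B W) (f b) c = W.coord (B W) (g b) c" for c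
    proof (cases "c \<in> B W")
      case True
      have "((to_nat_on (B V) b, to_nat_on (B W) c), W.coord (B W) (f b) c) \<in> mat V g W"
        unfolding eq [symmetric] using b True by (auto simp: mat_def)
      then obtain b' c' where "b' \<in> B V" "c' \<in> B W"
        "to_nat_on (B V) b = to_nat_on (B V) b'" "to_nat_on (B W) c = to_nat_on (B W) c'"
        "W.coord (B W) (f b) c = W.coord (B W) (g b') c'"
        by (auto simp: mat_def)
      then show ?thesis using b True B(2) VW by simp
    next
      case False
      then show ?thesis
        using W.fin_coeffsD(2) [OF W.coord_mem [OF B(1) [OF VW(2)]]] cl by simp
    qed
    then show "f b = g b" using W.coord_inject [OF B(1) [OF VW(2)] cl] by blast
  qed
  let ?C = "full_subcat (op_cat (Vec S K)) R"
  let ?enc = "\<lambda>(V, f, W). (V, W, mat V f W)"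
  have Arr: "Arr ?C \<subseteq> {(V, f, W). V \<in> R \<and> W \<in> R \<and> f \<in> module_hom K V W \<and> f \<in> extensional (carrier V)}"
    by (auto simp: full_subcat_def op_cat_def Vec_def)
  have "inj_on ?enc (Arr ?C)"
  proof (rule inj_onI)
    fix x y assume "x \<in> Arr ?C" "y \<in> Arr ?C" and e: "?enc x = ?enc y"
    then obtain V f W g where x: "x = (V, f, W)" "y = (V, g, W)"
      and "V \<in> R" "W \<in> R" "f \<in> module_hom K V W" "g \<in> module_hom K V W"
      and ext: "f \<in> extensional (carrier V)" "g \<in> extensional (carrier V)"
      and "mat V f W = mat V g W"
      using Arr by (auto split: prod.splits)
    then have "f = g" using mat_inj by (intro extensionalityI [OF ext]) blast
    then show "x = y" using x by simp
  qed
  moreover have "?enc ` Arr ?C \<subseteq> R \<times> R \<times> Pow (UNIV \<times> X)"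
    using mat_mem Arr by fastforce
  ultimately have "Arr ?C \<lesssim> R \<times> R \<times> Pow ((UNIV :: (nat \<times> nat) set) \<times> X)"
    unfolding lepoll_def by blast
  moreover have "small S (R \<times> R \<times> Pow ((UNIV :: (nat \<times> nat) set) \<times> X))"
    using S cR A by (intro small_Times small_countable small_Pow_countable_Times) auto
  ultimately have "small S (Arr ?C)" by (rule lepoll_small)
  moreover have "Obj ?C = R" by (simp add: full_subcat_def)
  ultimately show ?thesis using small_countable [OF S cR] by (simp add: small_cat_def)
qed

section \<open>Every space is a limit of spaces of countable dimension\<close>

lemma span_mem_countable_dim:
  assumes S: "universe S" and V: "V \<in> Obj (Vec S K)" and B: "vectorspace.basis K V B"
    and C: "C \<subseteq> B" "countable C"
  shows "V\<lparr>carrier := module.span K V C\<rparr> \<in> {V \<in> Obj (Vec S K). countable_dim K V}"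
proof -
  interpret vectorspace K V using V by (simp add: Vec_def)
  have CV: "C \<subseteq> carrier V" using B C by (auto simp: basis_def)
  interpret W: vectorspace K "vs (span C)" by (rule subspace_is_vs [OF span_is_subspace [OF CV]])
  have "S (span C)"
    using universe_subset [OF S _ span_is_subset2 [OF CV]] V by (simp add: Vec_def)
  moreover have "W.basis C"
    unfolding W.basis_def
    using span_li_not_depend [OF in_own_span [OF CV] span_is_submodule [OF CV]]
      subset_li_is_li [of B C] B C in_own_span [OF CV] by (simp add: basis_def)
  ultimately show ?thesis
    using C W.vectorspace_axioms by (auto simp: Vec_def countable_dim_def)
qed

text \<open>For countable \<open>C\<close> the idempotent \<^term>\<open>vectorspace.proj K V B C\<close> splits through a member of \<open>R\<close>,
  namely the representative \<open>Y\<close> of the span of \<open>C\<close>.\<close>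

lemma proj_factors_through_representative:
  assumes S: "universe S"
    and R: "representative_set (Vec S K) {V \<in> Obj (Vec S K). countable_dim K V} R"
    and V: "V \<in> Obj (Vec S K)" and B: "vectorspace.basis K V B"
    and C: "C \<subseteq> B" "countable C"
  shows "\<exists>Y q s. Y \<in> R \<and> q \<in> module_hom K V Y \<and> s \<in> module_hom K Y V \<and>
    (\<forall>y\<in>carrier Y. q (s y) = y) \<and> (\<forall>v\<in>carrier V. s (q v) = vectorspace.proj K V B C v)"
proof -
  interpret vectorspace K V using V by (simp add: Vec_def)
  have CV: "C \<subseteq> carrier V" using B C by (auto simp: basis_def)
  define W where "W = vs (span C)"
  have W: "W \<in> {V \<in> Obj (Vec S K). countable_dim K V}"
    unfolding W_def by (rule span_mem_countable_dim) fact+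
  have cW: "carrier W = span C" by (simp add: W_def)
  then obtain Y where Y: "Y \<in> R" "isomorphic (Vec S K) W Y"
    using R W unfolding representative_set_def by blast
  have "Y \<in> Obj (Vec S K)" using R Y by (auto simp: representative_set_def)
  then obtain f g where fg: "f \<in> module_hom K W Y" "g \<in> module_hom K Y W"
    "\<And>w. w \<in> span C \<Longrightarrow> g (f w) = w" "\<And>y. y \<in> carrier Y \<Longrightarrow> f (g y) = y"
    using Y W unfolding cW [symmetric] by (auto simp: isomorphic_Vec_iff)
  have p: "proj B C \<in> module_hom K V W"
    using proj_hom [OF B] proj_in_span [OF B, of _ C] C
    by (auto simp: module_hom_def W_def Int_absorb1)
  have g: "g \<in> module_hom K Y V"
    using fg(2) span_is_subset2 [OF CV] by (auto simp: module_hom_def W_def)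
  have "f \<circ> proj B C \<in> module_hom K V Y"
    using fg(1) p by (auto simp: module_hom_def Pi_iff)
  moreover have "(f \<circ> proj B C) (g y) = y" if "y \<in> carrier Y" for y
  proof -
    have "g y \<in> span C" using module_hom_closed [OF fg(2)] that by (auto simp: cW)
    then show ?thesis using fg(4) [OF that] by (simp add: proj_span [OF B _ C(1)])
  qed
  moreover have "g ((f \<circ> proj B C) v) = proj B C v" if "v \<in> carrier V" for v
    using that fg(3) proj_in_span [OF B that, of C] C by (auto simp: Int_absorb1)
  ultimately show ?thesis using Y g by blast
qed

text \<open>The category of a preorder \<open>P\<close>, with an arrow from \<open>i\<close> to \<open>j\<close> for each \<open>(i, j)\<close> in \<open>P\<close>. The
  injection \<open>e\<close> encodes the arrows as elements of a prescribed type.\<close>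

definition poset_category :: "('i \<times> 'i \<Rightarrow> 'j) \<Rightarrow> ('i \<times> 'i) set \<Rightarrow> ('i, 'j) category" where
  "poset_category e P =
    \<lparr>Obj = Field P, Arr = e ` P, Dom = fst \<circ> inv_into P e, Cod = snd \<circ> inv_into P e,
     Ident = (\<lambda>i. e (i, i)),
     Comp = (\<lambda>b a. e (fst (inv_into P e a), snd (inv_into P e b)))\<rparr>"

lemma is_category_poset_category:
  assumes e: "inj_on e P" and refl: "\<And>i. i \<in> Field P \<Longrightarrow> (i, i) \<in> P" and tr: "trans P"
  shows "is_category (poset_category e P)"
proof -
  let ?J = "poset_category e P"
  have assoc: "Comp ?J (e (k, l)) (Comp ?J (e (j, k)) (e (i, j))) =
      Comp ?J (Comp ?J (e (k, l)) (e (j, k))) (e (i, j))"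
    if "(i, j) \<in> P" "(j, k) \<in> P" "(k, l) \<in> P" for i j k l
    using that transD [OF tr that(1,2)] transD [OF tr that(2,3)]
    by (simp add: poset_category_def e)
  have comp: "Comp ?J (e (j, k)) (e (i, j)) \<in> homset ?J i k"
    if "(i, j) \<in> P" "(j, k) \<in> P" for i j k
    using that transD [OF tr that] by (simp add: poset_category_def homset_def e)
  show ?thesis
    unfolding is_category_def
  proof (intro conjI ballI impI)
    fix a b assume "a \<in> Arr ?J" "b \<in> Arr ?J" "Cod ?J a = Dom ?J b"
    then show "Comp ?J b a \<in> homset ?J (Dom ?J a) (Cod ?J b)"
      using comp by (auto simp: poset_category_def e)
  next
    fix a b c assume "a \<in> Arr ?J" "b \<in> Arr ?J" "c \<in> Arr ?J"
      "Cod ?J a = Dom ?J b" "Cod ?J b = Dom ?J c"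
    then show "Comp ?J c (Comp ?J b a) = Comp ?J (Comp ?J c b) a"
      using assoc by (auto simp: poset_category_def e)
  qed (use refl in \<open>auto simp: poset_category_def homset_def e FieldI1 FieldI2\<close>)
qed

text \<open>The diagram sends an inclusion of a set \<open>C\<close> in a countable subset \<open>D\<close> of \<open>B\<close> to the projection
  from the span of \<open>D\<close> to the span of \<open>C\<close>, transported along the isomorphisms with the
  representatives \<open>Y D\<close> and \<open>Y C\<close>; in the opposite category it points from \<open>Y C\<close> to \<open>Y D\<close>. Since
  \<open>s C \<circ> q C\<close> is the projection to the span of \<open>C\<close>, every equation reduces to one about projections
  of \<open>V\<close>, and the universal property is \<open>countable_amalgamation\<close>, applied to each element
  of the vertex \<open>Z\<close> of a cone.\<close>

lemma is_colimit_of_countable_projections: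
  fixes S :: "'u set \<Rightarrow> bool" and K :: "'k ring"
  assumes S: "universe S"
    and V: "V \<in> Obj (Vec S K)" and B: "vectorspace.basis K V B"
    and J: "J = poset_category e {(C, D). C \<subseteq> D \<and> D \<subseteq> B \<and> countable D}" 
    and e: "inj_on e {(C, D). C \<subseteq> D \<and> D \<subseteq> B \<and> countable D}" 
    and Y: "\<And>C. C \<subseteq> B \<Longrightarrow> countable C \<Longrightarrow> Y C \<in> R" and R: "R \<subseteq> Obj (Vec S K)"
    and q: "\<And>C. C \<subseteq> B \<Longrightarrow> countable C \<Longrightarrow> q C \<in> module_hom K V (Y C)"
    and s: "\<And>C. C \<subseteq> B \<Longrightarrow> countable C \<Longrightarrow> s C \<in> module_hom K (Y C) V"
    and qs: "\<And>C y. C \<subseteq> B \<Longrightarrow> countable C \<Longrightarrow> y \<in> carrier (Y C) \<Longrightarrow> q C (s C y) = y"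
    and sq: "\<And>C v. C \<subseteq> B \<Longrightarrow> countable C \<Longrightarrow> v \<in> carrier V \<Longrightarrow> s C (q C v) = vectorspace.proj K V B C v"
    and Fa: "Fa = (\<lambda>a. vec_arr (Y (Cod J a)) (q (Dom J a) \<circ> s (Cod J a)) (Y (Dom J a)))"
  shows "diagram J (full_subcat (op_cat (Vec S K)) R) Y Fa"
    and "is_colimit J (op_cat (Vec S K)) Y Fa V (\<lambda>C. vec_arr V (q C) (Y C))"
proof -
  let ?P = "{(C, D). C \<subseteq> D \<and> D \<subseteq> B \<and> countable D}"
  interpret V: vectorspace K V using V by (simp add: Vec_def)
  have YO: "Y C \<in> Obj (Vec S K)" if "C \<subseteq> B" "countable C" for C using Y R that by blast
  have q_cl: "q C v \<in> carrier (Y C)" if "C \<subseteq> B" "countable C" "v \<in> carrier V" for C v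
    using module_hom_closed [OF q] that by blast
  have s_cl: "s C y \<in> carrier V" if "C \<subseteq> B" "countable C" "y \<in> carrier (Y C)" for C y
    using module_hom_closed [OF s] that by blast
  have qs_hom: "q C \<circ> s D \<in> module_hom K (Y D) (Y C)"
    if "C \<subseteq> B" "countable C" "D \<subseteq> B" "countable D" for C D
    using q [OF that(1,2)] s [OF that(3,4)] by (auto simp: module_hom_def Pi_iff)
  have q_proj: "q C (V.proj B D v) = q C v"
    if "C \<subseteq> D" "D \<subseteq> B" "countable D" "v \<in> carrier V" for C D v
  proof -
    have C: "C \<subseteq> B" "countable C" using that countable_subset by auto
    have "q C (V.proj B D v) = q C (s C (q C (V.proj B D v)))"
      using C that V.proj_closed [OF B] by (simp add: qs q_cl)
    also have "\<dots> = q C (s C (q C v))"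
      using C that V.proj_closed [OF B] by (simp add: sq V.proj_proj [OF B] Int_absorb2)
    also have "\<dots> = q C v" using C that by (simp add: qs q_cl)
    finally show ?thesis .
  qed
  have Field: "Field ?P = {C. C \<subseteq> B \<and> countable C}"
    by (auto simp: Field_def intro: countable_subset)
  have J_simps: "Obj J = {C. C \<subseteq> B \<and> countable C}" "Arr J = e ` ?P"
    "Ident J C = e (C, C)" for C
    by (auto simp: J poset_category_def Field)
  have DC: "Dom J (e (C, D)) = C" "Cod J (e (C, D)) = D" 
    if "C \<subseteq> D" "D \<subseteq> B" "countable D" for C D
    using that by (simp_all add: J poset_category_def e)
  have Cm: "Comp J (e (D, E)) (e (C, D)) = e (C, E)" 
    if "C \<subseteq> D" "D \<subseteq> E" "E \<subseteq> B" "countable E" for C D E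
    using that countable_subset [of D E] by (simp add: J poset_category_def e)
  have Arr_cases: "\<exists>C D. a = e (C, D) \<and> C \<subseteq> D \<and> D \<subseteq> B \<and> C \<subseteq> B \<and> countable C \<and> countable D"
    if "a \<in> Arr J" for a
    using that countable_subset by (fastforce simp: J_simps)
  have Fa_e: "Fa (e (C, D)) = vec_arr (Y D) (q C \<circ> s D) (Y C)" 
    if "C \<subseteq> D" "D \<subseteq> B" "countable D" for C D
    using that by (simp add: Fa DC)
  have Fa_hom: "Fa (e (C, D)) \<in> homset (Vec S K) (Y D) (Y C)"
    if "C \<subseteq> D" "D \<subseteq> B" "countable D" for C D
    using that countable_subset [of C D] by (auto simp: Fa_e homset_Vec YO intro!: imageI qs_hom)
  show "diagram J (full_subcat (op_cat (Vec S K)) R) Y Fa"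
    unfolding diagram_def
  proof (intro conjI ballI impI)
    fix C assume "C \<in> Obj J"
    then show "Y C \<in> Obj (full_subcat (op_cat (Vec S K)) R)"
      using Y by (simp add: full_subcat_def J_simps)
  next
    fix a assume a': "a \<in> Arr J"
    obtain C D where a: "a = e (C, D)" "C \<subseteq> D" "D \<subseteq> B" "countable D" "C \<subseteq> B" "countable C"
      using Arr_cases [OF a'] by blast
    then show "Fa a \<in> homset (full_subcat (op_cat (Vec S K)) R) (Y (Dom J a)) (Y (Cod J a))"
      using Fa_hom [of C D] Y by (auto simp: DC homset_def full_subcat_def op_cat_def)
  next
    fix C assume "C \<in> Obj J"
    then show "Fa (Ident J C) = Ident (full_subcat (op_cat (Vec S K)) R) (Y C)"
      by (auto simp: J_simps Fa_e full_subcat_def op_cat_def Ident_Vec vec_arr_eq_iff qs)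
  next
    fix a b assume a': "a \<in> Arr J" and b': "b \<in> Arr J" and ab: "Cod J a = Dom J b"
    obtain C D where a: "a = e (C, D)" "C \<subseteq> D" "D \<subseteq> B" "countable D" "C \<subseteq> B" "countable C"
      using Arr_cases [OF a'] by blast
    obtain D' E where b: "b = e (D', E)" "D' \<subseteq> E" "E \<subseteq> B" "countable E"
      using Arr_cases [OF b'] by blast
    have [simp]: "D' = D" using ab a b by (simp add: DC)
    have "Fa (Comp J b a) = vec_arr (Y E) (q C \<circ> s E) (Y C)"
      using a b by (simp add: Cm Fa_e)
    also have "\<dots> = vec_arr (Y E) ((q C \<circ> s D) \<circ> (q D \<circ> s E)) (Y C)"
      using a b by (simp add: vec_arr_eq_iff sq s_cl q_proj)
    also have "\<dots> = Comp (Vec S K) (Fa a) (Fa b)"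
      using a b module_hom_closed [OF qs_hom [of D E]] by (simp add: Fa_e Comp_vec_arr)
    finally show "Fa (Comp J b a) = Comp (full_subcat (op_cat (Vec S K)) R) (Fa b) (Fa a)"
      by (simp add: full_subcat_def op_cat_def)
  qed
  have hom_op: "homset (op_cat (Vec S K)) X Z = homset (Vec S K) Z X" for X Z
    by (auto simp: homset_def op_cat_def)
  show "is_colimit J (op_cat (Vec S K)) Y Fa V (\<lambda>C. vec_arr V (q C) (Y C))"
    unfolding is_colimit_def
  proof (intro conjI allI impI)
    show "cocone J (op_cat (Vec S K)) Y Fa V (\<lambda>C. vec_arr V (q C) (Y C))"
      unfolding cocone_def
    proof (intro conjI ballI)
      show "V \<in> Obj (op_cat (Vec S K))" using V by (simp add: op_cat_def)
    next
      fix C assume "C \<in> Obj J"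
      then show "vec_arr V (q C) (Y C) \<in> homset (op_cat (Vec S K)) (Y C) V"
        by (auto simp: hom_op homset_Vec V YO J_simps intro!: imageI q)
    next
      fix a assume a': "a \<in> Arr J"
      obtain C D where a: "a = e (C, D)" "C \<subseteq> D" "D \<subseteq> B" "countable D" "C \<subseteq> B" "countable C"
        using Arr_cases [OF a'] by blast
      have "Comp (Vec S K) (Fa a) (vec_arr V (q D) (Y D)) = vec_arr V (q C) (Y C)"
        using a module_hom_closed [OF q [of D]]
        by (simp add: Fa_e Comp_vec_arr vec_arr_eq_iff sq q_proj)
      then show "Comp (op_cat (Vec S K)) (vec_arr V (q (Cod J a)) (Y (Cod J a))) (Fa a) =
          vec_arr V (q (Dom J a)) (Y (Dom J a))"
        using a by (simp add: op_cat_def DC)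
    qed
  next
    fix Z \<kappa> assume \<kappa>: "cocone J (op_cat (Vec S K)) Y Fa Z \<kappa>"
    then have Z: "Z \<in> Obj (Vec S K)" by (simp add: cocone_def op_cat_def)
    interpret Z: vectorspace K Z using Z by (simp add: Vec_def)
    have "\<forall>C\<in>Obj J. \<exists>k\<in>module_hom K Z (Y C). \<kappa> C = vec_arr Z k (Y C)"
      using \<kappa> unfolding cocone_def by (auto simp: hom_op homset_Vec Z YO J_simps)
    then obtain k where k: "\<And>C. C \<subseteq> B \<Longrightarrow> countable C \<Longrightarrow> k C \<in> module_hom K Z (Y C)"
      "\<And>C. C \<subseteq> B \<Longrightarrow> countable C \<Longrightarrow> \<kappa> C = vec_arr Z (k C) (Y C)"
      unfolding J_simps by (metis (no_types, lifting) mem_Collect_eq)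
    have k_cl: "k C z \<in> carrier (Y C)" if "C \<subseteq> B" "countable C" "z \<in> carrier Z" for C z
      using module_hom_closed [OF k(1)] that by blast
    have k_compat: "q C (s D (k D z)) = k C z"
      if "C \<subseteq> D" "D \<subseteq> B" "countable D" "z \<in> carrier Z" for C D z
    proof -
      have C: "C \<subseteq> B" "countable C" using that countable_subset by auto
      have "Comp (Vec S K) (Fa (e (C, D))) (\<kappa> D) = \<kappa> C"
        using \<kappa> that unfolding cocone_def by (force simp: J_simps DC op_cat_def)
      then have "vec_arr Z ((q C \<circ> s D) \<circ> k D) (Y C) = vec_arr Z (k C) (Y C)"
        using that C module_hom_closed [OF k(1) [of D]] by (simp add: Fa_e Comp_vec_arr k(2))
      then show ?thesis using that by (simp add: vec_arr_eq_iff)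
    qed
    \<comment> \<open>The values of the mediating map; its linearity follows from their uniqueness.\<close>
    have amalg: "\<exists>!x. x \<in> carrier V \<and> (\<forall>C. C \<subseteq> B \<longrightarrow> countable C \<longrightarrow> q C x = k C z)"
      if z: "z \<in> carrier Z" for z
    proof -
      have "\<exists>!x. x \<in> carrier V \<and> (\<forall>C. C \<subseteq> B \<longrightarrow> countable C \<longrightarrow> V.proj B C x = s C (k C z))"
      proof (rule V.countable_amalgamation [OF B])
        fix C assume "C \<subseteq> B" "countable C"
        then show "s C (k C z) \<in> carrier V" using z by (intro s_cl k_cl)
      next
        fix C D assume CD: "C \<subseteq> D" "D \<subseteq> B" "countable D"
        then have C: "C \<subseteq> B" "countable C" using countable_subset by auto
        show "V.proj B C (s D (k D z)) = s C (k C z)"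
          using CD C z sq [of C "s D (k D z)"] by (simp add: s_cl k_cl k_compat)
      qed
      moreover have "V.proj B C x = s C (k C z) \<longleftrightarrow> q C x = k C z"
        if C: "C \<subseteq> B" "countable C" and "x \<in> carrier V" for C x
        using that z by (metis sq qs q_cl k_cl)
      ultimately show ?thesis by (smt (verit, ccfv_SIG))
    qed
    define h where "h z = (THE x. x \<in> carrier V \<and> (\<forall>C. C \<subseteq> B \<longrightarrow> countable C \<longrightarrow> q C x = k C z))" for z
    have h: "h z \<in> carrier V" "\<And>C. C \<subseteq> B \<Longrightarrow> countable C \<Longrightarrow> q C (h z) = k C z"
      if "z \<in> carrier Z" for z
      using theI' [OF amalg [OF that]] unfolding h_def by blast+
    have h_unique: "x = h z" if "z \<in> carrier Z" "x \<in> carrier V"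
      "\<And>C. C \<subseteq> B \<Longrightarrow> countable C \<Longrightarrow> q C x = k C z" for x z
      using amalg [OF that(1)] h [OF that(1)] that(2,3) by blast
    have h_hom: "h \<in> module_hom K Z V"
      unfolding module_hom_def
    proof (intro CollectI conjI allI impI; (elim conjE)?)
      show "h \<in> carrier Z \<rightarrow> carrier V" using h by auto
    next
      fix z w assume "z \<in> carrier Z" "w \<in> carrier Z"
      then show "h (z \<oplus>\<^bsub>Z\<^esub> w) = h z \<oplus>\<^bsub>V\<^esub> h w"
        by (intro h_unique [symmetric]) (auto simp: h module_hom_add [OF q] module_hom_add [OF k(1)])
    next
      fix r z assume "r \<in> carrier K" "z \<in> carrier Z"
      then show "h (r \<odot>\<^bsub>Z\<^esub> z) = r \<odot>\<^bsub>V\<^esub> h z"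
        by (intro h_unique [symmetric]) (auto simp: h module_hom_smult [OF q] module_hom_smult [OF k(1)])
    qed
    have Comp_iff: "Comp (op_cat (Vec S K)) (vec_arr Z g V) (vec_arr V (q C) (Y C)) = \<kappa> C \<longleftrightarrow>
        (\<forall>z\<in>carrier Z. q C (g z) = k C z)"
      if "g \<in> module_hom K Z V" "C \<subseteq> B" "countable C" for g C
      using that by (simp add: op_cat_def Comp_vec_arr module_hom_closed k(2) vec_arr_eq_iff)
    show "\<exists>!h. h \<in> homset (op_cat (Vec S K)) V Z \<and>
        (\<forall>C\<in>Obj J. Comp (op_cat (Vec S K)) h (vec_arr V (q C) (Y C)) = \<kappa> C)"
    proof (rule ex1I)
      show "vec_arr Z h V \<in> homset (op_cat (Vec S K)) V Z \<and>
        (\<forall>C\<in>Obj J. Comp (op_cat (Vec S K)) (vec_arr Z h V) (vec_arr V (q C) (Y C)) = \<kappa> C)"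
        using h h_hom by (auto simp: hom_op homset_Vec V Z J_simps Comp_iff)
    next
      fix g' assume g': "g' \<in> homset (op_cat (Vec S K)) V Z \<and>
        (\<forall>C\<in>Obj J. Comp (op_cat (Vec S K)) g' (vec_arr V (q C) (Y C)) = \<kappa> C)"
      then obtain g where g: "g \<in> module_hom K Z V" "g' = vec_arr Z g V"
        by (auto simp: hom_op homset_Vec V Z)
      have "q C (g z) = k C z" if "z \<in> carrier Z" "C \<subseteq> B" "countable C" for C z
        using g' that unfolding g(2) by (simp add: J_simps Comp_iff g(1))
      then have "g z = h z" if "z \<in> carrier Z" for z
        using that module_hom_closed [OF g(1)] by (intro h_unique) auto
      then show "g' = vec_arr Z h V" by (simp add: g(2) vec_arr_eq_iff)
    qed
  qed
qed

theorem proposition4p2: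
  fixes K :: "'k ring" and S :: "'u set \<Rightarrow> bool" and R :: "('k, 'u) module set"
  assumes "field K"
    and "universe S"
    and "representative_set (Vec S K) {V \<in> Obj (Vec S K). countable_dim K V} R"
  shows "colimit_dense S (op_cat (Vec S K)) R"
  unfolding colimit_dense_def
proof (intro conjI ballI)
  have R: "R \<subseteq> Obj (Vec S K)" using assms(3) by (auto simp: representative_set_def)
  then show "R \<subseteq> Obj (op_cat (Vec S K))" by (simp add: op_cat_def)
  show "small_cat S (full_subcat (op_cat (Vec S K)) R)"
    using assms(2,3) by (rule small_cat_representatives)
  fix V assume "V \<in> Obj (op_cat (Vec S K))"
  then have V: "V \<in> Obj (Vec S K)" by (simp add: op_cat_def)
  interpret V: vectorspace K V using V by (simp add: Vec_def)
  obtain B where B: "V.basis B" using V.basis_exists by blast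
  let ?P = "{(C, D). C \<subseteq> D \<and> D \<subseteq> B \<and> countable D}"
  have "S B"
    by (rule universe_subset [OF assms(2), of "carrier V"]) (use V B in \<open>auto simp: Vec_def V.basis_def\<close>)
  then have sB: "small S (Pow B)" unfolding small_def by blast
  have sP: "small S ?P"
    by (rule small_subset [OF _ small_Times [OF assms(2) sB sB]]) auto
  \<comment> \<open>Small sets embed into the type \<open>'u set\<close>, which is to contain the arrows of the index category.\<close>
  then obtain e :: "'u set \<times> 'u set \<Rightarrow> 'u set" where e: "inj_on e ?P"
    by (auto simp: small_def lepoll_def)
  let ?J = "poset_category e ?P"
  have J: "is_category ?J"
    by (rule is_category_poset_category [OF e]) (auto simp: Field_def trans_def intro: countable_subset)
  have "Obj ?J \<subseteq> Pow B" by (auto simp: poset_category_def Field_def)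
  then have "small S (Obj ?J)" using sB small_subset by blast
  moreover have "Arr ?J \<lesssim> ?P" by (simp add: poset_category_def image_lepoll)
  then have "small S (Arr ?J)" using sP by (rule lepoll_small)
  ultimately have smallJ: "small_cat S ?J" by (simp add: small_cat_def)
  define splits where "splits C Y q s \<longleftrightarrow> Y \<in> R \<and> q \<in> module_hom K V Y \<and> s \<in> module_hom K Y V \<and>
    (\<forall>y\<in>carrier Y. q (s y) = y) \<and> (\<forall>v\<in>carrier V. s (q v) = V.proj B C v)" for C Y q s
  have "\<forall>C. C \<subseteq> B \<and> countable C \<longrightarrow> (\<exists>Y q s. splits C Y q s)"
    unfolding splits_def by (intro allI impI proj_factors_through_representative [OF assms(2,3) V B]) auto
  then obtain Y q s where "\<And>C. C \<subseteq> B \<and> countable C \<Longrightarrow> splits C (Y C) (q C) (s C)"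
    by metis
  then have *: "Y C \<in> R" "q C \<in> module_hom K V (Y C)" "s C \<in> module_hom K (Y C) V"
    "\<And>y. y \<in> carrier (Y C) \<Longrightarrow> q C (s C y) = y" "\<And>v. v \<in> carrier V \<Longrightarrow> s C (q C v) = V.proj B C v"
    if "C \<subseteq> B" "countable C" for C
    using that by (simp_all add: splits_def)
  have "diagram ?J (full_subcat (op_cat (Vec S K)) R) Y
        (\<lambda>a. vec_arr (Y (Cod ?J a)) (q (Dom ?J a) \<circ> s (Cod ?J a)) (Y (Dom ?J a)))"
    by (rule is_colimit_of_countable_projections(1) [OF assms(2) V B refl e]) (use * R in auto)
  moreover have "is_colimit ?J (op_cat (Vec S K)) Y
        (\<lambda>a. vec_arr (Y (Cod ?J a)) (q (Dom ?J a) \<circ> s (Cod ?J a)) (Y (Dom ?J a))) V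
        (\<lambda>C. vec_arr V (q C) (Y C))"
    by (rule is_colimit_of_countable_projections(2) [OF assms(2) V B refl e]) (use * R in auto)
  ultimately show "\<exists>(J :: ('u set, 'u set) category) Fo Fa \<iota>.
      is_category J \<and> small_cat S J \<and> diagram J (full_subcat (op_cat (Vec S K)) R) Fo Fa \<and>
      is_colimit J (op_cat (Vec S K)) Fo Fa V \<iota>"
    using J smallJ by blast
qed

end
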